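(* For any integers $a\ge 1$ and $0\le k\le a$ there is an experiment graph of the form $\mathtt{G}(a,b,\sigma)$ producing $\left|D_k^a\right\rangle$ on the $a$ signal modes, i.e. $\left|\psi_{\mathtt{G}(a,b,\sigma)}\right\rangle\propto\left|D_k^a\right\rangle\otimes\left|0\right\rangle^{\otimes b}$, using $n=2\max(k,a-k)$ paths, $b=|a-2k|$ spectators, and $a(a-1)+ab$ crystals, with $\sigma=\text{sink}$ if $k<a/2$ and $\sigma=\text{source}$ if $k>a/2$; if $k=a/2$, no spectator modes are needed ($b=0$). The (unnormalized) amplitude of each term is $(n/2)!$, i.e. for each $S\subseteq A$ with $|S|=k$ exactly $(n/2)!$ coincidences $M$ satisfy $\operatorname{sig}(M)=S$, and the number of contributing coincidences is $a!/\bigl(\min(k,a-k)\bigr)!$.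
   Context: An experiment graph is a finite loopless multigraph $G=(V,E)$ (vertices are called paths, edges are called crystals; parallel edges are distinct crystals) together with a half-edge coloring assigning to each of the two arms (edge–endpoint incidences) of each crystal a mode: excited ($1$) or ground ($0$). For a crystal $e$, $R(e)$ is the set of endpoints of $e$ at which the arm of $e$ is excited. A coincidence is a perfect matching $M$ of $G$ (a set of edges covering every vertex exactly once). The registered pattern of a coincidence $M$ is $\operatorname{sig}(M)=\bigsqcup_{e\in M}R(e)\subseteq V$, identified with the bitstring in $\{0,1\}^V$ that is its indicator vector. All crystals have weight $1$. The (unnormalized) post-selected state is $\left|\psi_G\right\rangle\propto\sum_{M}\left|\operatorname{sig}(M)\right\rangle=\sum_{x\in\{0,1\}^V}\mu(x)\left|x\right\rangle$, the first sum being over all perfect matchings $M$ of $G$, where $\mu(x)$ is the number of perfect matchings $M$ with $\operatorname{sig}(M)=x$ and $\left|x\right\rangle$ is the computational basis vector indexed by $x$; $\mu(x)$ is the unnormalized amplitude of $\left|x\right\rangle$. The experiment graph $\mathtt{G}(a,b,\sigma)$ is defined for integers $a\ge1$, $0\le b\le a$, $a\equiv b\pmod 2$, and $\sigma\in\{\text{sink},\text{source}\}$ (with $\sigma=\text{sink}$ when $b=0$): its vertex set is the disjoint union $A\sqcup B$ with $|A|=a$ (signal paths) and $|B|=b$ (spectator paths), so it has $n=a+b$ paths. For each pair $\{i,j\}\subseteq A$ with $i\ne j$ there are exactly two parallel crystals, one excited at $i$ and ground at $j$, the other ground at $i$ and excited at $j$. There are no crystals between two vertices of $B$. Each $v\in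 B$ is joined to each $i\in A$ by a single crystal, which is ground at both $i$ and $v$ if $\sigma=\text{sink}$, and excited at $i$ and ground at $v$ if $\sigma=\text{source}$. The Dicke state is $\left|D_k^N\right\rangle=\binom{N}{k}^{-1/2}\sum_{x\in\{0,1\}^N,\,H(x)=k}\left|x\right\rangle$, where $H(x)$ is the Hamming weight (number of ones). In $\left|D_k^a\right\rangle\otimes\left|0\right\rangle^{\otimes b}$ the first $a$ modes are those of $A$ and the last $b$ are those of $B$. *)

theory Defs
  imports Complex_Main
begin

datatype arm_mode = Ground | Excited

text \<open>
  Crystals are abstract labels, so parallel crystals are distinct.  The field \<open>arm e v\<close> is the
  mode of the arm of \<open>e\<close> at \<open>v\<close>; it is meaningful only when \<open>v\<close> is an endpoint of \<open>e\<close>.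
\<close>

record ('v, 'e) exp_graph =
  paths :: "'v set"
  crystals :: "'e set"
  ends :: "'e \<Rightarrow> 'v set"
  arm :: "'e \<Rightarrow> 'v \<Rightarrow> arm_mode"

definition experiment_graph :: "('v, 'e) exp_graph \<Rightarrow> bool" where
  "experiment_graph G \<longleftrightarrow>
     finite (paths G) \<and> finite (crystals G) \<and>
     (\<forall>e \<in> crystals G. ends G e \<subseteq> paths G \<and> card (ends G e) = 2)"

definition excited_ends :: "('v, 'e) exp_graph \<Rightarrow> 'e \<Rightarrow> 'v set" where
  "excited_ends G e = {v \<in> ends G e. arm G e v = Excited}"

definition coincidence :: "('v, 'e) exp_graph \<Rightarrow> 'e set \<Rightarrow> bool" where
  "coincidence G M \<longleftrightarrow>
     M \<subseteq> crystals G \<and> (\<forall>v \<in> paths G. \<exists>!e. e \<in> M \<and> v \<in> ends G e)"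

definition sig :: "('v, 'e) exp_graph \<Rightarrow> 'e set \<Rightarrow> 'v set" where
  "sig G M = (\<Union>e \<in> M. excited_ends G e)"

lemma sig_disjoint:
  assumes "experiment_graph G" "coincidence G M" "e \<in> M" "f \<in> M" "e \<noteq> f"
  shows "excited_ends G e \<inter> excited_ends G f = {}"
  using assms unfolding experiment_graph_def coincidence_def excited_ends_def by blast

text \<open>
  A bitstring in \<open>{0,1}\<^sup>V\<close> is represented by the subset of \<open>V\<close> of which it is the indicator
  vector, so its Hamming weight is the cardinality, and the all-zero string is \<open>{}\<close>.  A state is
  its family of amplitudes; those of the states below vanish at sets that are not subsets of
  the set of modes.
\<close>

type_synonym 'v state = "'v set \<Rightarrow> complex"

definition ket :: "'v set \<Rightarrow> 'v state" where
  "ket x = (\<lambda>y. if y = x then 1 else 0)"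

definition proportional :: "'v state \<Rightarrow> 'v state \<Rightarrow> bool" (infix "\<propto>" 50) where
  "\<phi> \<propto> \<chi> \<longleftrightarrow> (\<exists>c. c \<noteq> 0 \<and> \<phi> = (\<lambda>x. c * \<chi> x))"

definition tensor :: "'v state \<Rightarrow> 'w state \<Rightarrow> ('v + 'w) state" (infixr "\<otimes>" 70) where
  "\<phi> \<otimes> \<chi> = (\<lambda>x. \<phi> (Inl -` x) * \<chi> (Inr -` x))"

definition dicke :: "nat \<Rightarrow> nat \<Rightarrow> nat state" where
  "dicke N k = (\<lambda>y. complex_of_real (1 / sqrt (real (N choose k))) *
                     (\<Sum>x | x \<subseteq> {..<N} \<and> card x = k. ket x y))"

definition psi :: "('v, 'e) exp_graph \<Rightarrow> 'v state" where
  "psi G = (\<lambda>y. \<Sum>M | coincidence G M. ket (sig G M) y)"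

definition mu :: "('v, 'e) exp_graph \<Rightarrow> 'v set \<Rightarrow> nat" where
  "mu G x = card {M. coincidence G M \<and> sig G M = x}"

lemma psi_eq_mu:
  assumes "experiment_graph G"
  shows "psi G x = of_nat (mu G x)"
proof -
  have "{M. coincidence G M} \<subseteq> Pow (crystals G)"
    by (auto simp: coincidence_def)
  then have fin: "finite {M. coincidence G M}"
    using assms by (meson experiment_graph_def finite_Pow_iff finite_subset)
  have "psi G x = (\<Sum>M | coincidence G M. if sig G M = x then 1 else 0)"
    by (auto simp: psi_def ket_def intro: sum.cong)
  also have "\<dots> = (\<Sum>M \<in> {M \<in> {M. coincidence G M}. sig G M = x}. 1)"
    by (rule sum.inter_filter[OF fin, symmetric])
  finally show ?thesis by (simp add: mu_def)
qed

datatype orientation = Sink | Source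

text \<open>
  Signal path \<open>i\<close> is \<open>Inl i\<close> and spectator path \<open>v\<close> is \<open>Inr v\<close>.  The crystal \<open>SS i j\<close> joins the
  signal paths \<open>i\<close> and \<open>j\<close> and is excited at \<open>i\<close> and ground at \<open>j\<close>; its parallel partner is
  \<open>SS j i\<close>.  The crystal \<open>SB i v\<close> joins signal path \<open>i\<close> to spectator path \<open>v\<close>.
\<close>

datatype crystal = SS nat nat | SB nat nat

fun crystal_ends :: "crystal \<Rightarrow> (nat + nat) set" where
  "crystal_ends (SS i j) = {Inl i, Inl j}"
| "crystal_ends (SB i v) = {Inl i, Inr v}"

fun crystal_arm :: "orientation \<Rightarrow> crystal \<Rightarrow> nat + nat \<Rightarrow> arm_mode" where
  "crystal_arm \<sigma> (SS i j) p = (if p = Inl i then Excited else Ground)"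
| "crystal_arm \<sigma> (SB i v) p = (if \<sigma> = Source \<and> p = Inl i then Excited else Ground)"

definition GG :: "nat \<Rightarrow> nat \<Rightarrow> orientation \<Rightarrow> (nat + nat, crystal) exp_graph" where
  "GG a b \<sigma> =
     \<lparr> paths = {..<a} <+> {..<b},
       crystals = {SS i j | i j. i < a \<and> j < a \<and> i \<noteq> j} \<union> {SB i v | i v. i < a \<and> v < b},
       ends = crystal_ends,
       arm = crystal_arm \<sigma> \<rparr>"

definition admissible :: "nat \<Rightarrow> nat \<Rightarrow> orientation \<Rightarrow> bool" where
  "admissible a b \<sigma> \<longleftrightarrow> 1 \<le> a \<and> b \<le> a \<and> a mod 2 = b mod 2 \<and> (b = 0 \<longrightarrow> \<sigma> = Sink)"

end

theory Submission
  imports Defs "HOL-Library.FuncSet"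
begin

text \<open>
  Orient every crystal of \<open>GG a b \<sigma>\<close> away from a signal endpoint, its root: a signal-spectator
  crystal has only one choice, and a signal-signal crystal is rooted at its excited end when
  \<open>\<sigma> = Source\<close> and at its ground end when \<open>\<sigma> = Sink\<close>.  The registered pattern of a coincidence is
  then the set \<open>T\<close> of its roots (for \<open>Source\<close>) or the complement of \<open>T\<close> among the signal paths (for
  \<open>Sink\<close>).  Every path outside \<open>T\<close> is the head of exactly one crystal, so the coincidences with
  root set \<open>T\<close> are the bijections from \<open>T\<close> to the remaining paths; this forces \<open>T\<close> to contain half of
  all paths, and there are \<open>(n/2)!\<close> coincidences for each such \<open>T\<close>.
\<close>

section \<open>Crystals as pairs of a root and a head\<close>

fun link :: "orientation \<Rightarrow> nat \<Rightarrow> nat + nat \<Rightarrow> crystal" where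
  "link Sink t (Inl i) = SS i t"
| "link Source t (Inl i) = SS t i"
| "link \<sigma> t (Inr v) = SB t v"

lemma link_eq_iff [simp]: "link \<sigma> t p = link \<sigma> t' p' \<longleftrightarrow> t = t' \<and> p = p'"
  by (cases \<sigma>; cases p; cases p') auto

lemma crystal_ends_link [simp]: "crystal_ends (link \<sigma> t p) = {Inl t, p}"
  by (cases \<sigma>; cases p) auto

definition roots :: "orientation \<Rightarrow> crystal set \<Rightarrow> nat set" where
  "roots \<sigma> M = {t. \<exists>p. link \<sigma> t p \<in> M}"

lemma finite_paths_GG [simp]: "finite (paths (GG a b \<sigma>))"
  by (simp add: GG_def)

lemma card_paths_GG [simp]: "card (paths (GG a b \<sigma>)) = a + b"
  by (simp add: GG_def card_Plus)

lemma mem_paths_GG [simp]: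
  "Inl i \<in> paths (GG a b \<sigma>) \<longleftrightarrow> i < a"
  "Inr v \<in> paths (GG a b \<sigma>) \<longleftrightarrow> v < b"
  by (auto simp: GG_def)

lemma ends_GG [simp]: "ends (GG a b \<sigma>) = crystal_ends"
  by (simp add: GG_def)

text \<open>In terms of \<open>link\<close> the two kinds of crystal and the two orientations look
  alike: any signal path is a root, and any other path can be its head.\<close>

lemma crystals_GG:
  "crystals (GG a b \<sigma>) = {link \<sigma> t p | t p. t < a \<and> p \<in> paths (GG a b \<sigma>) \<and> p \<noteq> Inl t}"
    (is "?C = ?L")
proof (intro equalityI subsetI)
  fix e assume "e \<in> ?C"
  then consider i j where "e = SS i j" "i < a" "j < a" "i \<noteq> j" | i v where "e = SB i v" "i < a" "v < b"
    by (auto simp: GG_def)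
  then show "e \<in> ?L"
  proof cases
    case 1
    show ?thesis
    proof (cases \<sigma>)
      case Sink
      \<comment> \<open>For \<open>Sink\<close> the root is the ground end \<open>j\<close>, for
        \<open>Source\<close> the excited end \<open>i\<close>.\<close>
      with 1 show ?thesis by (intro CollectI exI[of _ j] exI[of _ "Inl i"]) auto
    next
      case Source
      with 1 show ?thesis by (intro CollectI exI[of _ i] exI[of _ "Inl j"]) auto
    qed
  next
    case 2
    then show ?thesis by (intro CollectI exI[of _ i] exI[of _ "Inr v"]) auto
  qed
next
  fix e assume "e \<in> ?L"
  then obtain t p where "e = link \<sigma> t p" "t < a" "p \<in> paths (GG a b \<sigma>)" "p \<noteq> Inl t"
    by blast
  then show "e \<in> ?C"
    by (cases \<sigma>; cases p) (auto simp: GG_def)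
qed

text \<open>For \<open>Sink\<close> the head is the excited end if it is a signal path; a crystal to
  a spectator has no excited end, which is what removing \<open>range Inr\<close> expresses.\<close>

lemma excited_ends_link:
  "excited_ends (GG a b \<sigma>) (link \<sigma> t p) =
     (if \<sigma> = Source then {Inl t} else {p} - range Inr)"
  by (cases \<sigma>; cases p) (auto simp: excited_ends_def GG_def)

text \<open>Each of the \<open>a\<close> roots can be combined with \<open>a + b - 1\<close> heads,
  and \<open>link\<close> is injective.\<close>

lemma card_crystals_GG: "card (crystals (GG a b \<sigma>)) = a * (a - 1) + a * b"
proof -
  have "crystals (GG a b \<sigma>) =
      (\<lambda>(t, p). link \<sigma> t p) ` (SIGMA t:{..<a}. paths (GG a b \<sigma>) - {Inl t})"
    by (auto simp: crystals_GG)
  also have "card \<dots> = card (SIGMA t:{..<a}. paths (GG a b \<sigma>) - {Inl t})"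
    by (rule card_image) (auto simp: inj_on_def)
  also have "\<dots> = (\<Sum>t<a. a + b - 1)"
    by (simp add: card_SigmaI)
  also have "\<dots> = a * (a - 1) + a * b"
    by (cases a) (auto simp: algebra_simps)
  finally show ?thesis .
qed

lemma experiment_graph_GG: "experiment_graph (GG a b \<sigma>)"
proof -
  have "finite (crystals (GG a b \<sigma>))"
  proof (rule finite_subset)
    show "crystals (GG a b \<sigma>) \<subseteq> (\<lambda>(t, p). link \<sigma> t p) ` ({..<a} \<times> paths (GG a b \<sigma>))"
      by (auto simp: crystals_GG)
  qed simp
  then show ?thesis
    by (auto simp: experiment_graph_def crystals_GG card_insert_if)
qed

section \<open>Coincidences as bijections from roots to the other paths\<close>

lemma finite_coincidences:
  assumes "experiment_graph G"
  shows "finite {M. coincidence G M}"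
proof (rule finite_subset)
  show "{M. coincidence G M} \<subseteq> Pow (crystals G)"
    by (auto simp: coincidence_def)
qed (use assms in \<open>simp add: experiment_graph_def\<close>)

lemma coincidence_unique:
  assumes "coincidence G M" "v \<in> paths G" "e \<in> M" "v \<in> ends G e" "f \<in> M" "v \<in> ends G f"
  shows "e = f"
  using assms unfolding coincidence_def by blast

lemma coincidence_GG_memE:
  assumes "coincidence (GG a b \<sigma>) M" "e \<in> M"
  obtains t p where "e = link \<sigma> t p" "t < a" "p \<in> paths (GG a b \<sigma>)" "p \<noteq> Inl t"
  using assms unfolding coincidence_def crystals_GG by blast

lemma roots_subset: "coincidence (GG a b \<sigma>) M \<Longrightarrow> roots \<sigma> M \<subseteq> {..<a}"
  unfolding roots_def by (force elim: coincidence_GG_memE)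

text \<open>The head of the crystal rooted at \<open>t\<close>; a junk value unless \<open>t\<close> is a root.\<close>

definition head :: "orientation \<Rightarrow> crystal set \<Rightarrow> nat \<Rightarrow> nat + nat" where
  "head \<sigma> M t = (THE p. link \<sigma> t p \<in> M)"

text \<open>Two crystals of \<open>M\<close> rooted at \<open>t\<close> share the path
  \<open>Inl t\<close>, hence are equal. So \<open>M\<close> is the graph of the function
  \<open>head \<sigma> M\<close> on the roots.\<close>

lemma link_mem_iff_head:
  assumes "coincidence (GG a b \<sigma>) M"
  shows "link \<sigma> t p \<in> M \<longleftrightarrow> t \<in> roots \<sigma> M \<and> p = head \<sigma> M t"
proof -
  have uniq: "q = r" if "link \<sigma> t q \<in> M" "link \<sigma> t r \<in> M" for q r
  proof -
    have "t < a"
      using roots_subset[OF assms] that by (auto simp: roots_def)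
    then have "link \<sigma> t q = link \<sigma> t r"
      using that by (intro coincidence_unique[OF assms, of "Inl t"]) auto
    then show ?thesis by simp
  qed
  have "link \<sigma> t (head \<sigma> M t) \<in> M" if root: "t \<in> roots \<sigma> M"
  proof -
    obtain p where p: "link \<sigma> t p \<in> M"
      using root by (auto simp: roots_def)
    then show ?thesis
      unfolding head_def by (rule theI) (rule uniq[OF _ p])
  qed
  moreover have "t \<in> roots \<sigma> M" if "link \<sigma> t p \<in> M"
    using that unfolding roots_def by blast
  ultimately show ?thesis
    using uniq by metis
qed

lemma coincidence_eq_image:
  assumes "coincidence (GG a b \<sigma>) M"
  shows "M = (\<lambda>t. link \<sigma> t (head \<sigma> M t)) ` roots \<sigma> M"
proof (intro equalityI subsetI)
  fix e assume e: "e \<in> M"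
  obtain t p where "e = link \<sigma> t p"
    by (rule coincidence_GG_memE[OF assms e])
  with e link_mem_iff_head[OF assms] show "e \<in> (\<lambda>t. link \<sigma> t (head \<sigma> M t)) ` roots \<sigma> M"
    by simp
next
  fix e assume "e \<in> (\<lambda>t. link \<sigma> t (head \<sigma> M t)) ` roots \<sigma> M"
  then show "e \<in> M"
    by (auto simp: link_mem_iff_head[OF assms])
qed

text \<open>Crystals of \<open>M\<close> that share a path are equal, so heads are distinct and
  never roots. A path that is not a root is still covered, so it is the head of the crystal covering
  it.\<close>

lemma bij_betw_head:
  assumes M: "coincidence (GG a b \<sigma>) M"
  shows "bij_betw (head \<sigma> M) (roots \<sigma> M) (paths (GG a b \<sigma>) - Inl ` roots \<sigma> M)"
proof -
  let ?P = "paths (GG a b \<sigma>)" and ?T = "roots \<sigma> M" and ?f = "head \<sigma> M"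
  have mem: "link \<sigma> t (?f t) \<in> M" if "t \<in> ?T" for t
    using that link_mem_iff_head[OF M] by blast
  have head: "?f t \<in> ?P" "?f t \<noteq> Inl t" if "t \<in> ?T" for t
    using coincidence_GG_memE[OF M mem[OF that]] by auto
  \<comment> \<open>One statement for both clashes: a head equal to another head gives injectivity,
    and a head equal to a root \<open>t'\<close> forces \<open>t = t'\<close>, which contradicts
    \<open>?f t \<noteq> Inl t\<close>.\<close>
  have hit: "t = t'" if "t \<in> ?T" "t' \<in> ?T" "?f t \<in> {Inl t', ?f t'}" for t t'
    using coincidence_unique[OF M head(1)[OF that(1)] mem[OF that(1)] _ mem[OF that(2)]] that(3)
    by auto
  have "inj_on ?f ?T"
    using hit by (auto simp: inj_on_def)
  moreover have "?f ` ?T \<subseteq> ?P - Inl ` ?T"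
    using hit head by fastforce
  moreover have "p \<in> ?f ` ?T" if p: "p \<in> ?P" "p \<notin> Inl ` ?T" for p
  proof -
    obtain e where "e \<in> M" "p \<in> crystal_ends e"
      using M p(1) unfolding coincidence_def by auto
    obtain t where "t \<in> ?T" "e = link \<sigma> t (?f t)"
      using \<open>e \<in> M\<close> coincidence_eq_image[OF M] by (metis imageE)
    with \<open>p \<in> crystal_ends e\<close> p(2) show ?thesis by auto
  qed
  ultimately show ?thesis
    unfolding bij_betw_def by blast
qed

text \<open>The bijection from roots to the remaining paths makes the roots exactly half of all
  paths.\<close>

lemma card_roots:
  assumes "coincidence (GG a b \<sigma>) M"
  shows "2 * card (roots \<sigma> M) = a + b"
proof -
  have sub: "Inl ` roots \<sigma> M \<subseteq> paths (GG a b \<sigma>)"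
    using roots_subset[OF assms] by auto
  have "card (roots \<sigma> M) = card (paths (GG a b \<sigma>) - Inl ` roots \<sigma> M)"
    using bij_betw_head[OF assms] by (rule bij_betw_same_card)
  also have "\<dots> = a + b - card (roots \<sigma> M)"
    using sub by (simp add: card_Diff_subset finite_subset card_image)
  finally show ?thesis
    using card_mono[OF _ sub] by (simp add: card_image)
qed

text \<open>A path in \<open>Inl\<close> T\<open>is covered only by the crystal rooted there,
  because heads avoid\<close>Inl \<open>T\<close>; any other path is the head of exactly one
  root.\<close>

lemma coincidence_of_bij:
  assumes T: "T \<subseteq> {..<a}" and f: "bij_betw f T (paths (GG a b \<sigma>) - Inl ` T)"
  shows "coincidence (GG a b \<sigma>) ((\<lambda>t. link \<sigma> t (f t)) ` T)"
  unfolding coincidence_def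
proof (intro conjI ballI)
  have f_mem: "f t \<in> paths (GG a b \<sigma>)" "f t \<notin> Inl ` T" if "t \<in> T" for t
    using f that by (auto simp: bij_betw_def)
  show "(\<lambda>t. link \<sigma> t (f t)) ` T \<subseteq> crystals (GG a b \<sigma>)"
  proof (clarify)
    fix t assume t: "t \<in> T"
    then have "t < a"
      using T by auto
    moreover have "f t \<noteq> Inl t"
      using f_mem(2)[OF t] t by auto
    ultimately show "link \<sigma> t (f t) \<in> crystals (GG a b \<sigma>)"
      unfolding crystals_GG using f_mem(1)[OF t] by blast
  qed
  fix v assume v: "v \<in> paths (GG a b \<sigma>)"
  obtain t where t: "t \<in> T" "v = Inl t \<or> v = f t"
    and uniq: "\<And>t'. t' \<in> T \<Longrightarrow> v = Inl t' \<or> v = f t' \<Longrightarrow> t' = t"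
  proof (cases "v \<in> Inl ` T")
    case True
    then obtain t where "t \<in> T" "v = Inl t" by blast
    then show ?thesis
      using f_mem(2) by (intro that[of t]) force+
  next
    case False
    have inj: "inj_on f T"
      using f by (simp add: bij_betw_def)
    have "v \<in> f ` T"
      using v False f by (simp add: bij_betw_def)
    then obtain t where "t \<in> T" "v = f t" by blast
    then show ?thesis
      using False inj_onD[OF inj] by (intro that[of t]) auto
  qed
  show "\<exists>!e. e \<in> (\<lambda>t. link \<sigma> t (f t)) ` T \<and> v \<in> ends (GG a b \<sigma>) e"
  proof (rule ex1I[of _ "link \<sigma> t (f t)"])
    show "link \<sigma> t (f t) \<in> (\<lambda>t. link \<sigma> t (f t)) ` T \<and> v \<in> ends (GG a b \<sigma>) (link \<sigma> t (f t))"
      using t by simp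
  next
    fix e assume "e \<in> (\<lambda>t. link \<sigma> t (f t)) ` T \<and> v \<in> ends (GG a b \<sigma>) e"
    then show "e = link \<sigma> t (f t)"
      using uniq by fastforce
  qed
qed

section \<open>Counting coincidences with a given root set\<close>

text \<open>Between finite sets of equal size every injection is a bijection, and the count of
  injections is a falling factorial.\<close>

lemma card_bijections:
  assumes "finite A" "finite B" "card A = card B"
  shows "card {f \<in> A \<rightarrow>\<^sub>E B. bij_betw f A B} = fact (card A)"
proof -
  have "{f \<in> A \<rightarrow>\<^sub>E B. bij_betw f A B} = {f \<in> A \<rightarrow>\<^sub>E B. inj_on f A}"
  proof -
    have "bij_betw f A B" if "f \<in> A \<rightarrow>\<^sub>E B" and inj: "inj_on f A" for f
    proof -
      have "f ` A \<subseteq> B" "card (f ` A) = card B"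
        using that assms by (auto simp: card_image)
      then show ?thesis
        using inj assms by (simp add: bij_betw_def card_subset_eq)
    qed
    then show ?thesis
      by (auto simp: bij_betw_def)
  qed
  also have "card \<dots> = (\<Prod>i = 0..<card A. card A - i)"
    using card_inj_on_subset_funcset[OF assms(1,2) order_refl] assms(3) by simp
  also have "\<dots> = fact (card A)"
    by (simp add: fact_prod_rev)
  finally show ?thesis .
qed

text \<open>Sending a bijection \<open>f\<close> to the crystals
  \<open>link \<sigma> t (f t)\<close> is inverse to taking heads, so there are as many coincidences
  as bijections.\<close>

lemma card_coincidences_with_roots:
  assumes T: "T \<subseteq> {..<a}" and card_T: "2 * card T = a + b"
  shows "card {M. coincidence (GG a b \<sigma>) M \<and> roots \<sigma> M = T} = fact (card T)"
proof -
  let ?P = "paths (GG a b \<sigma>) - Inl ` T"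
  let ?F = "{f \<in> T \<rightarrow>\<^sub>E ?P. bij_betw f T ?P}"
  let ?C = "{M. coincidence (GG a b \<sigma>) M \<and> roots \<sigma> M = T}"
  let ?h = "\<lambda>f. (\<lambda>t. link \<sigma> t (f t)) ` T"
  have fin: "finite T"
    using T by (rule finite_subset) simp
  have "Inl ` T \<subseteq> paths (GG a b \<sigma>)"
    using T by auto
  then have "card T = card ?P"
    using card_T fin by (simp add: card_Diff_subset card_image)
  then have "card ?F = fact (card T)"
    using fin by (intro card_bijections) auto
  moreover have "bij_betw ?h ?F ?C"
  proof (intro bij_betw_imageI equalityI subsetI)
    show "inj_on ?h ?F"
    proof (rule inj_onI)
      fix f g assume "f \<in> ?F" "g \<in> ?F" and eq: "?h f = ?h g"
      moreover have "f t = g t" if "t \<in> T" for t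
      proof -
        have "link \<sigma> t (f t) \<in> ?h g"
          using that by (simp flip: eq)
        then show ?thesis by auto
      qed
      ultimately show "f = g"
        by (blast intro: PiE_ext)
    qed
  next
    fix M assume "M \<in> ?h ` ?F"
    then obtain f where "bij_betw f T ?P" "M = ?h f" by blast
    then show "M \<in> ?C"
      using coincidence_of_bij[OF T] by (auto simp: roots_def)
  next
    fix M assume "M \<in> ?C"
    then have M: "coincidence (GG a b \<sigma>) M" and [simp]: "roots \<sigma> M = T" by auto
    \<comment> \<open>Outside \<open>T\<close> the values of \<open>head\<close> are junk;
      restricting makes the function extensional.\<close>
    let ?f = "restrict (head \<sigma> M) T"
    have "bij_betw ?f T ?P"
      using bij_betw_head[OF M] by simp
    then have "?f \<in> ?F"
      by (auto simp: bij_betw_def)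
    moreover have "M = ?h ?f"
      using coincidence_eq_image[OF M] by simp
    ultimately show "M \<in> ?h ` ?F" by blast
  qed
  ultimately show ?thesis
    by (simp add: bij_betw_same_card)
qed

section \<open>Registered patterns and amplitudes\<close>

text \<open>For \<open>Source\<close> each crystal is excited at its root alone. For
  \<open>Sink\<close> the excited ends are the signal paths among the heads, and the heads are all
  the paths that are not roots.\<close>

lemma sig_eq_roots:
  assumes M: "coincidence (GG a b \<sigma>) M"
  shows "sig (GG a b \<sigma>) M = Inl ` (if \<sigma> = Source then roots \<sigma> M else {..<a} - roots \<sigma> M)"
proof -
  let ?T = "roots \<sigma> M" and ?f = "head \<sigma> M" and ?P = "paths (GG a b \<sigma>)"
  have sig: "sig (GG a b \<sigma>) M = (\<Union>t\<in>?T. excited_ends (GG a b \<sigma>) (link \<sigma> t (?f t)))"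
    unfolding sig_def by (subst coincidence_eq_image[OF M]) simp
  have heads: "?f ` ?T = ?P - Inl ` ?T"
    using bij_betw_head[OF M] by (simp add: bij_betw_def)
  show ?thesis
  proof (cases \<sigma>)
    case Source
    with sig show ?thesis by (auto simp: excited_ends_link)
  next
    case Sink
    have "sig (GG a b \<sigma>) M = (\<Union>t\<in>?T. {?f t} - range Inr)"
      using Sink sig by (simp add: excited_ends_link)
    also have "\<dots> = ?f ` ?T - range Inr"
      by blast
    also have "\<dots> = Inl ` ({..<a} - ?T)"
      unfolding heads by (auto simp: GG_def)
    finally show ?thesis using Sink by simp
  qed
qed

lemma mu_GG:
  assumes "S \<subseteq> {..<a}" and "2 * card (if \<sigma> = Source then S else {..<a} - S) = a + b"
  shows "mu (GG a b \<sigma>) (Inl ` S) = fact ((a + b) div 2)"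
proof -
  \<comment> \<open>The only root set that registers as \<open>S\<close>.\<close>
  define T where "T = (if \<sigma> = Source then S else {..<a} - S)"
  have T: "T \<subseteq> {..<a}" "2 * card T = a + b"
    using assms by (auto simp: T_def)
  have "sig (GG a b \<sigma>) M = Inl ` S \<longleftrightarrow> roots \<sigma> M = T" if "coincidence (GG a b \<sigma>) M" for M
    using assms(1) roots_subset[OF that]
    by (auto simp: sig_eq_roots[OF that] inj_image_eq_iff T_def)
  then have "mu (GG a b \<sigma>) (Inl ` S) = card {M. coincidence (GG a b \<sigma>) M \<and> roots \<sigma> M = T}"
    unfolding mu_def by (intro arg_cong[where f = card]) blast
  with card_coincidences_with_roots[OF T] show ?thesis by (simp flip: T(2))
qed

lemma mu_GG_nonzero:
  assumes "mu (GG a b \<sigma>) y \<noteq> 0"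
  obtains S where "y = Inl ` S" "S \<subseteq> {..<a}"
    "2 * card (if \<sigma> = Source then S else {..<a} - S) = a + b"
proof -
  have "{M. coincidence (GG a b \<sigma>) M \<and> sig (GG a b \<sigma>) M = y} \<noteq> {}"
    using assms unfolding mu_def by (metis card.empty)
  then obtain M where M: "coincidence (GG a b \<sigma>) M" "sig (GG a b \<sigma>) M = y"
    by blast
  \<comment> \<open>For \<open>Sink\<close> the pattern is the complement of the roots, and the size
    condition complements it once more.\<close>
  have *: "{..<a} - ({..<a} - roots \<sigma> M) = roots \<sigma> M"
    using roots_subset[OF M(1)] by blast
  show ?thesis
    using sig_eq_roots[OF M(1)] M(2) roots_subset[OF M(1)] card_roots[OF M(1)] *
    by (intro that[of "if \<sigma> = Source then roots \<sigma> M else {..<a} - roots \<sigma> M"]) auto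
qed

text \<open>Sort the coincidences by root set: each of the \<open>m\<close>-element sets of signal
  paths contributes \<open>fact m\<close>.\<close>

lemma card_coincidences_GG:
  assumes "a + b = 2 * m"
  shows "card {M. coincidence (GG a b \<sigma>) M} = (a choose m) * fact m"
proof -
  let ?\<T> = "{T. T \<subseteq> {..<a} \<and> card T = m}"
  let ?C = "\<lambda>T. {M. coincidence (GG a b \<sigma>) M \<and> roots \<sigma> M = T}"
  have "{M. coincidence (GG a b \<sigma>) M} = (\<Union>T\<in>?\<T>. ?C T)"
    using roots_subset card_roots assms by fastforce
  also have "card \<dots> = (\<Sum>T\<in>?\<T>. card (?C T))"
    using finite_coincidences[OF experiment_graph_GG]
    by (intro card_UN_disjoint) auto
  also have "\<dots> = (\<Sum>T\<in>?\<T>. fact m)"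
    using assms by (intro sum.cong) (auto simp: card_coincidences_with_roots)
  also have "\<dots> = (a choose m) * fact m"
    using n_subsets[of "{..<a}" m] by simp
  finally show ?thesis .
qed

section \<open>Comparison with the Dicke state\<close>

lemma dicke_apply:
  "dicke N k y =
     (if y \<subseteq> {..<N} \<and> card y = k then complex_of_real (1 / sqrt (real (N choose k))) else 0)"
proof -
  have "finite {x. x \<subseteq> {..<N} \<and> card x = k}"
    by (rule finite_subset[of _ "Pow {..<N}"]) auto
  then show ?thesis
    by (simp add: dicke_def ket_def)
qed

text \<open>The factor \<open>ket {}\<close> kills every \<open>y\<close> containing a spectator;
  any other \<open>y\<close> is the image of its signal part.\<close>

lemma tensor_dicke_ket_empty:
  "(dicke N k \<otimes> ket {}) y =
     (if \<exists>S \<subseteq> {..<N}. card S = k \<and> y = Inl ` S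
      then complex_of_real (1 / sqrt (real (N choose k))) else 0)"
proof (cases "Inr -` y = {}")
  case True
  then have y: "y = Inl ` (Inl -` y)"
    by (auto simp: image_iff vimage_def) (metis sum.exhaust)
  then have "(\<exists>S \<subseteq> {..<N}. card S = k \<and> y = Inl ` S) \<longleftrightarrow> Inl -` y \<subseteq> {..<N} \<and> card (Inl -` y) = k"
    by (metis inj_Inl inj_vimage_image_eq)
  with True show ?thesis
    by (simp add: tensor_def ket_def dicke_apply)
next
  case False
  then have "\<nexists>S. y = Inl ` S" by auto
  with False show ?thesis by (auto simp: tensor_def ket_def)
qed

text \<open>The hypothesis \<open>card_iff\<close> translates the forced number of roots into
  Hamming weight \<open>k\<close>, so the amplitude is constant on that weight and zero
  elsewhere.\<close>

lemma psi_GG: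
  assumes "k \<le> a"
    and card_iff: "\<And>S. S \<subseteq> {..<a} \<Longrightarrow>
      2 * card (if \<sigma> = Source then S else {..<a} - S) = a + b \<longleftrightarrow> card S = k"
  shows "psi (GG a b \<sigma>) \<propto> dicke a k \<otimes> ket {}"
proof -
  \<comment> \<open>The common amplitude times the inverse of the normalization of the Dicke
    state.\<close>
  define c where "c = complex_of_real (fact ((a + b) div 2) * sqrt (real (a choose k)))"
  have pos: "0 < real (a choose k)"
    using assms(1) by simp
  have "psi (GG a b \<sigma>) y = c * (dicke a k \<otimes> ket {}) y" for y
  proof (cases "\<exists>S \<subseteq> {..<a}. card S = k \<and> y = Inl ` S")
    case True
    then have "mu (GG a b \<sigma>) y = fact ((a + b) div 2)"
      using mu_GG card_iff by metis
    with True pos show ?thesis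
      by (simp add: psi_eq_mu[OF experiment_graph_GG] tensor_dicke_ket_empty c_def)
  next
    case False
    then have "mu (GG a b \<sigma>) y = 0"
      using mu_GG_nonzero card_iff by metis
    with False show ?thesis
      by (auto simp: psi_eq_mu[OF experiment_graph_GG] tensor_dicke_ket_empty)
  qed
  moreover have "c \<noteq> 0"
    using pos by (simp add: c_def)
  ultimately show ?thesis
    unfolding proportional_def by blast
qed

theorem mainTheorem4:
  fixes a k :: nat
  assumes "1 \<le> a" and "k \<le> a"
  shows "\<exists>(b :: nat) (\<sigma> :: orientation).
    admissible a b \<sigma> \<and>
    int b = \<bar>int a - 2 * int k\<bar> \<and>
    (2 * k < a \<longrightarrow> \<sigma> = Sink) \<and>
    (2 * k > a \<longrightarrow> \<sigma> = Source) \<and>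
    (2 * k = a \<longrightarrow> b = 0) \<and>
    experiment_graph (GG a b \<sigma>) \<and>
    psi (GG a b \<sigma>) \<propto> dicke a k \<otimes> ket {} \<and>
    card (paths (GG a b \<sigma>)) = 2 * max k (a - k) \<and>
    card (crystals (GG a b \<sigma>)) = a * (a - 1) + a * b \<and>
    (\<forall>S \<subseteq> {..<a}. card S = k \<longrightarrow>
       mu (GG a b \<sigma>) (Inl ` S) = fact (card (paths (GG a b \<sigma>)) div 2)) \<and>
    real (card {M. coincidence (GG a b \<sigma>) M}) = fact a / fact (min k (a - k))"
proof -
  \<comment> \<open>Half of the \<open>a + b\<close> paths are roots. A weight-\<open>k\<close>
    pattern has \<open>k\<close> roots for \<open>Source\<close> and \<open>a - k\<close> for
    \<open>Sink\<close>, which dictates \<open>b\<close>.\<close>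
  define b where "b = (if 2 * k \<le> a then a - 2 * k else 2 * k - a)"
  \<comment> \<open>The balanced case \<open>2 * k = a\<close> goes to \<open>Sink\<close>, as
    \<open>admissible\<close> demands when \<open>b = 0\<close>.\<close>
  define \<sigma> where "\<sigma> = (if 2 * k \<le> a then Sink else Source)"
  define m where "m = max k (a - k)"
  have ab: "a + b = 2 * m"
    using assms by (auto simp: b_def m_def)
  have card_iff: "2 * card (if \<sigma> = Source then S else {..<a} - S) = a + b \<longleftrightarrow> card S = k"
    if S: "S \<subseteq> {..<a}" for S
  proof -
    have "card S \<le> a" "card ({..<a} - S) = a - card S"
      using card_mono[OF _ S] S by (auto simp: card_Diff_subset finite_subset)
    with assms(2) show ?thesis
      by (auto simp: \<sigma>_def b_def)
  qed
  have "admissible a b \<sigma>"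
  proof -
    have "a mod 2 = b mod 2"
      using ab by presburger
    with assms show ?thesis
      by (auto simp: admissible_def b_def \<sigma>_def)
  qed
  moreover have "int b = \<bar>int a - 2 * int k\<bar>" "2 * k < a \<longrightarrow> \<sigma> = Sink" "2 * k > a \<longrightarrow> \<sigma> = Source"
      "2 * k = a \<longrightarrow> b = 0"
    by (auto simp: b_def \<sigma>_def)
  moreover have "psi (GG a b \<sigma>) \<propto> dicke a k \<otimes> ket {}"
    using assms(2) card_iff by (rule psi_GG)
  moreover have "card (paths (GG a b \<sigma>)) = 2 * max k (a - k)"
    using ab by (simp add: m_def)
  moreover have "\<forall>S \<subseteq> {..<a}. card S = k \<longrightarrow>
      mu (GG a b \<sigma>) (Inl ` S) = fact (card (paths (GG a b \<sigma>)) div 2)"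
    using mu_GG card_iff by simp
  moreover have "real (card {M. coincidence (GG a b \<sigma>) M}) = fact a / fact (min k (a - k))"
  proof -
    \<comment> \<open>These turn \<open>(a choose m) * fact m\<close> into
      \<open>fact a / fact (a - m)\<close>, with the required denominator.\<close>
    have "m \<le> a" "a - m = min k (a - k)"
      using assms(2) by (auto simp: m_def)
    then show ?thesis
      by (simp add: card_coincidences_GG[OF ab] binomial_fact)
  qed
  ultimately show ?thesis
    using experiment_graph_GG card_crystals_GG by blast
qed

end
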